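(* Let $K,K'$ be edge-path connected simplicial complexes with $\dim(K)$ finite, and let $\varphi,\psi:K\to K'$ be simplicial maps. Then $$\mathrm{SD}_0(\varphi,\psi)\le\dots\le\mathrm{SD}_{\dim(K)}(\varphi,\psi)=\mathrm{SD}_{\dim(K)+1}(\varphi,\psi)=\dots=\mathrm{SD}(\varphi,\psi),$$ that is, the sequence $\mathrm{SD}_m(\varphi,\psi)$ is non-decreasing in $m\ge 0$ and equals $\mathrm{SD}(\varphi,\psi)$ for every $m\ge\dim(K)$.
   Context: Simplicial complexes are abstract simplicial complexes. Simplicial maps $f,g:A\to B$ are contiguous, $f\sim_c g$, if for every simplex $\{v_0,\dots,v_k\}$ of $A$ the set $\{f(v_0),\dots,f(v_k),g(v_0),\dots,g(v_k)\}$ is a simplex of $B$. They are in the same contiguity class, $f\sim g$, if there is a finite sequence of simplicial maps $f=f_0\sim_c f_1\sim_c\dots\sim_c f_n=g$ from $A$ to $B$. The contiguity distance $\mathrm{SD}(\varphi,\psi)$ is the least integer $k\ge 0$ such that $K$ is covered by subcomplexes $K_0,\dots,K_k$ with $\varphi|_{K_j}\sim\psi|_{K_j}$ for all $j$ ($\infty$ if no such cover exists). For an integer $m\ge 0$, the $m$-contiguity distance $\mathrm{SD}_m(\varphi,\psi)$ is the least integer $k\ge 0$ such that $K$ is covered by subcomplexes $K_0,\dots,K_k$ with the property that for each $j$ and every simplicial map $\eta:P\to K_j$ from an $m$-dimensional simplicial complex $P$, $\varphi\circ\eta\sim\psi\circ\eta$ ($\infty$ if no such cover exists). *)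

theory Defs
  imports Main "HOL-Library.Extended_Nat"
begin

text \<open>An abstract simplicial complex is represented by its set of (nonempty, finite) simplices; its
  vertex set is \<open>\<Union>K\<close>. The empty complex is allowed. A map of complexes is a total function on the
  vertex type; only its values on \<open>\<Union>K\<close> matter, so restriction to a subcomplex leaves the
  function unchanged and only replaces the domain.\<close>

definition abstract_complex :: "'a set set \<Rightarrow> bool" where
  "abstract_complex K \<longleftrightarrow>
     (\<forall>s\<in>K. finite s \<and> s \<noteq> {}) \<and> (\<forall>s\<in>K. \<forall>t. t \<subseteq> s \<and> t \<noteq> {} \<longrightarrow> t \<in> K)"

definition subcomplex :: "'a set set \<Rightarrow> 'a set set \<Rightarrow> bool" where
  "subcomplex L K \<longleftrightarrow> abstract_complex L \<and> L \<subseteq> K"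

text \<open>Truncated subtraction is harmless because simplices are nonempty. The empty complex gets
  dimension \<open>0\<close> instead of \<open>-1\<close>; where this would matter, nonemptiness is stated separately.\<close>

definition complex_dim :: "'a set set \<Rightarrow> enat" where
  "complex_dim K = (SUP s\<in>K. enat (card s - 1))"

definition edge_path_connected :: "'a set set \<Rightarrow> bool" where
  "edge_path_connected K \<longleftrightarrow> (\<forall>u\<in>\<Union>K. \<forall>v\<in>\<Union>K. (u, v) \<in> {(x, y). {x, y} \<in> K}\<^sup>*)"

definition simplicial_map :: "'a set set \<Rightarrow> 'b set set \<Rightarrow> ('a \<Rightarrow> 'b) \<Rightarrow> bool" where
  "simplicial_map A B f \<longleftrightarrow> (\<forall>s\<in>A. f ` s \<in> B)"

definition contiguous :: "'a set set \<Rightarrow> 'b set set \<Rightarrow> ('a \<Rightarrow> 'b) \<Rightarrow> ('a \<Rightarrow> 'b) \<Rightarrow> bool" where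
  "contiguous A B f g \<longleftrightarrow>
     simplicial_map A B f \<and> simplicial_map A B g \<and> (\<forall>s\<in>A. f ` s \<union> g ` s \<in> B)"

definition same_contiguity_class ::
    "'a set set \<Rightarrow> 'b set set \<Rightarrow> ('a \<Rightarrow> 'b) \<Rightarrow> ('a \<Rightarrow> 'b) \<Rightarrow> bool" where
  "same_contiguity_class A B f g \<longleftrightarrow>
     (\<exists>n h. h (0::nat) = f \<and> h n = g \<and> (\<forall>i\<le>n. simplicial_map A B (h i)) \<and>
        (\<forall>i<n. contiguous A B (h i) (h (Suc i))))"

text \<open>The least \<open>k\<close> such that \<open>K\<close> is a union of \<open>k + 1\<close> subcomplexes \<open>L 0, \<dots>, L k\<close> all satisfying
  \<open>Q\<close>; the infimum of the empty set is \<open>\<infinity>\<close>.\<close>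

definition cover_number :: "('a set set \<Rightarrow> bool) \<Rightarrow> 'a set set \<Rightarrow> enat" where
  "cover_number Q K =
     Inf {enat k |k. \<exists>L. (\<forall>j\<le>k. subcomplex (L j) K \<and> Q (L j)) \<and> (\<Union>j\<le>k. L j) = K}"

definition SD :: "'a set set \<Rightarrow> 'b set set \<Rightarrow> ('a \<Rightarrow> 'b) \<Rightarrow> ('a \<Rightarrow> 'b) \<Rightarrow> enat" where
  "SD K K' \<phi> \<psi> = cover_number (\<lambda>L. same_contiguity_class L K' \<phi> \<psi>) K"

text \<open>A definition cannot quantify over the vertex type of the test complex \<open>P\<close>, so \<open>P\<close> ranges over
  the complexes with vertices in \<open>'a + nat\<close>. The lemma \<open>m_contiguous_on_any_vertex_type\<close>
  shows that this is no restriction: the property then holds for \<open>P\<close> over an arbitrary type.\<close>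

definition m_contiguous_on ::
    "nat \<Rightarrow> 'a set set \<Rightarrow> 'b set set \<Rightarrow> ('a \<Rightarrow> 'b) \<Rightarrow> ('a \<Rightarrow> 'b) \<Rightarrow> bool" where
  "m_contiguous_on m L K' \<phi> \<psi> \<longleftrightarrow>
     (\<forall>(P :: ('a + nat) set set) \<eta>.
        abstract_complex P \<and> P \<noteq> {} \<and> complex_dim P = enat m \<and> simplicial_map P L \<eta>
        \<longrightarrow> same_contiguity_class P K' (\<phi> \<circ> \<eta>) (\<psi> \<circ> \<eta>))"

definition SDm :: "nat \<Rightarrow> 'a set set \<Rightarrow> 'b set set \<Rightarrow> ('a \<Rightarrow> 'b) \<Rightarrow> ('a \<Rightarrow> 'b) \<Rightarrow> enat" where
  "SDm m K K' \<phi> \<psi> = cover_number (\<lambda>L. m_contiguous_on m L K' \<phi> \<psi>) K"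

lemma same_contiguity_class_compose:
  assumes "same_contiguity_class A B f g" "simplicial_map P A \<theta>"
  shows "same_contiguity_class P B (f \<circ> \<theta>) (g \<circ> \<theta>)"
proof -
  obtain n h where h: "h (0::nat) = f" "h n = g" "\<forall>i\<le>n. simplicial_map A B (h i)"
    "\<forall>i<n. contiguous A B (h i) (h (Suc i))"
    using assms(1) unfolding same_contiguity_class_def by blast
  have s: "\<forall>i\<le>n. simplicial_map P B (h i \<circ> \<theta>)"
    using h(3) assms(2) unfolding simplicial_map_def image_comp[symmetric] by blast
  have "\<forall>i<n. contiguous P B (h i \<circ> \<theta>) (h (Suc i) \<circ> \<theta>)"
    using h(4) assms(2)
    unfolding contiguous_def simplicial_map_def image_comp[symmetric] by blast
  with s h(1,2) show ?thesis
    unfolding same_contiguity_class_def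
    by (intro exI[of _ n] exI[of _ "\<lambda>i. h i \<circ> \<theta>"]) auto
qed

lemma m_contiguous_on_any_vertex_type:
  fixes P :: "'p set set" and L :: "'a set set"
  assumes good: "m_contiguous_on m L K' \<phi> \<psi>"
    and L: "abstract_complex L"
    and P: "abstract_complex P" "P \<noteq> {}" "complex_dim P = enat m"
    and \<eta>: "simplicial_map P L \<eta>"
  shows "same_contiguity_class P K' (\<phi> \<circ> \<eta>) (\<psi> \<circ> \<eta>)"
proof -
  obtain s0 where "s0 \<in> P" using P(2) by blast
  then have "\<eta> ` s0 \<in> L" using \<eta> by (simp add: simplicial_map_def)
  moreover have "\<eta> ` s0 \<noteq> {}" using P(1) \<open>s0 \<in> P\<close> by (auto simp: abstract_complex_def)
  moreover have "t \<in> L" if "s \<in> L" "t \<subseteq> s" "t \<noteq> {}" for s t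
    using L that unfolding abstract_complex_def by blast
  ultimately obtain v0 where v0: "{v0} \<in> L"
    by (metis empty_subsetI ex_in_conv insert_not_empty insert_subset)
  define S where "S = {s \<in> L. card s \<le> Suc m}"
  define D where "D = {t :: ('a + nat) set. t \<noteq> {} \<and> t \<subseteq> Inr ` {..m}}"
  define Q where "Q = (\<lambda>s. Inl ` s) ` S \<union> D"
  define \<theta> where "\<theta> = case_sum id (\<lambda>_::nat. v0)"
  have topD: "Inr ` {..m} \<in> D" by (auto simp: D_def)
  have cardtop: "card ((Inr :: nat \<Rightarrow> 'a + nat) ` {..m}) = Suc m"
    by (simp add: card_image)
  have cardQ: "card t \<le> Suc m" if "t \<in> Q" for t
    using that
  proof (unfold Q_def, elim UnE)
    assume "t \<in> D"
    then show ?thesis using card_mono[of "Inr ` {..m}" t] cardtop by (simp add: D_def)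
  qed (auto simp: S_def card_image)
  have "abstract_complex Q"
    unfolding abstract_complex_def
  proof (intro conjI ballI allI impI)
    fix s assume "s \<in> Q"
    then consider r where "r \<in> L" "s = Inl ` r" | "s \<noteq> {}" "s \<subseteq> Inr ` {..m}"
      unfolding Q_def S_def D_def by blast
    then have "finite s \<and> s \<noteq> {}"
    proof cases
      case 1
      then show ?thesis using L by (simp add: abstract_complex_def)
    next
      case 2
      then show ?thesis using finite_subset by blast
    qed
    then show "finite s" "s \<noteq> {}" by blast+
    fix t assume t: "t \<subseteq> s \<and> t \<noteq> {}"
    show "t \<in> Q"
    proof (cases "s \<in> D")
      case True
      then show ?thesis using t by (auto simp: Q_def D_def)
    next
      case False
      then obtain r where r: "r \<in> L" "card r \<le> Suc m" "s = Inl ` r"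
        using \<open>s \<in> Q\<close> by (auto simp: Q_def S_def)
      then obtain q where q: "q \<subseteq> r" "t = Inl ` q" using t by (auto elim: subset_imageE)
      have "finite r" using L r(1) by (simp add: abstract_complex_def)
      then have "card q \<le> Suc m" using q(1) r(2) card_mono[of r q] by linarith
      moreover have "q \<in> L" using L r(1) q t unfolding abstract_complex_def by blast
      ultimately show ?thesis using q by (auto simp: Q_def S_def)
    qed
  qed
  moreover have "Q \<noteq> {}" using topD by (auto simp: Q_def)
  moreover have "complex_dim Q = enat m"
    unfolding complex_dim_def
  proof (rule antisym)
    show "(SUP s\<in>Q. enat (card s - 1)) \<le> enat m"
      using cardQ by (intro SUP_least) fastforce
    have "enat (card ((Inr :: nat \<Rightarrow> 'a + nat) ` {..m}) - 1) \<le> (SUP s\<in>Q. enat (card s - 1))"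
      using topD by (intro SUP_upper) (simp add: Q_def)
    then show "enat m \<le> (SUP s\<in>Q. enat (card s - 1))" by (simp only: cardtop) simp
  qed
  moreover have "simplicial_map Q L \<theta>"
    unfolding simplicial_map_def
  proof
    fix s assume "s \<in> Q"
    then consider r where "r \<in> L" "s = Inl ` r" | "s \<noteq> {}" "s \<subseteq> Inr ` {..m}"
      unfolding Q_def S_def D_def by blast
    then show "\<theta> ` s \<in> L"
    proof cases
      case 1
      then show ?thesis by (simp add: \<theta>_def image_image)
    next
      case 2
      then have "\<forall>x\<in>s. \<theta> x = v0" by (auto simp: \<theta>_def)
      with 2(1) have "\<theta> ` s = {v0}" by (metis image_cong image_constant_conv)
      then show ?thesis using v0 by simp
    qed
  qed
  ultimately have c: "same_contiguity_class Q K' (\<phi> \<circ> \<theta>) (\<psi> \<circ> \<theta>)"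
    using good by (simp add: m_contiguous_on_def)
  have "simplicial_map P Q (Inl \<circ> \<eta>)"
    unfolding simplicial_map_def
  proof
    fix s assume s: "s \<in> P"
    have "enat (card s - 1) \<le> enat m"
      using SUP_upper[OF s, of "\<lambda>s. enat (card s - 1)"] P(3) by (simp add: complex_dim_def)
    moreover have "finite s" using s P(1) by (simp add: abstract_complex_def)
    ultimately have "card (\<eta> ` s) \<le> Suc m" using card_image_le[of s \<eta>] by simp
    then have "\<eta> ` s \<in> S" using \<eta> s by (simp add: S_def simplicial_map_def)
    then show "(Inl \<circ> \<eta>) ` s \<in> Q"
      unfolding Q_def image_comp[symmetric] by blast
  qed
  from same_contiguity_class_compose[OF c this] show ?thesis
    by (simp add: \<theta>_def comp_def)
qed

end

(* The m-dimensional test condition passes to every test complex P of dimension at most m: the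
   disjoint union of P with an m-simplex, collapsed to a vertex, is m-dimensional. This gives
   monotonicity in m. If dim K <= m, every subcomplex L of K can itself be tested with the identity,
   so the test condition on L is just the equality of the contiguity classes. *)

theory Submission
  imports Defs
begin

lemma cover_number_mono:
  assumes "\<And>L. subcomplex L K \<Longrightarrow> Q L \<Longrightarrow> Q' L"
  shows "cover_number Q' K \<le> cover_number Q K"
  unfolding cover_number_def by (intro Inf_superset_mono) (use assms in blast)

lemma card_simplex_le:
  assumes "complex_dim P \<le> enat m" "s \<in> P"
  shows "card s \<le> Suc m"
proof -
  have "enat (card s - 1) \<le> complex_dim P"
    unfolding complex_dim_def using assms(2) by (rule SUP_upper)
  with assms(1) have "enat (card s - 1) \<le> enat m" by (rule order_trans[rotated])
  \<comment> \<open>Truncated subtraction does no harm: the bound also holds when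
    \<open>card s = 0\<close>.\<close>
  then show ?thesis by simp
qed

lemma complex_dim_mono: "L \<subseteq> K \<Longrightarrow> complex_dim L \<le> complex_dim K"
  unfolding complex_dim_def by (rule SUP_subset_mono) auto

text \<open>A chain of length one is needed because its ends must equal \<open>f\<close> and
  \<open>g\<close> as total functions; contiguity itself is vacuous.\<close>

lemma same_contiguity_class_empty: "same_contiguity_class {} B f g"
  unfolding same_contiguity_class_def
  by (intro exI[of _ 1] exI[of _ "\<lambda>i. if i = 0 then f else g"])
    (simp add: contiguous_def simplicial_map_def)

lemma m_contiguous_on_dim_le:
  fixes P :: "'p set set" and L :: "'a set set"
  assumes good: "m_contiguous_on m L K' \<phi> \<psi>"
    and L: "abstract_complex L"
    and P: "abstract_complex P" "complex_dim P \<le> enat m"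
    and \<eta>: "simplicial_map P L \<eta>"
  shows "same_contiguity_class P K' (\<phi> \<circ> \<eta>) (\<psi> \<circ> \<eta>)"
proof (cases "P = {}")
  case True
  then show ?thesis by (simp add: same_contiguity_class_empty)
next
  case False
  \<comment> \<open>A vertex \<open>v\<close> of \<open>P\<close> yields the vertex
    \<open>\<eta> v\<close> of \<open>L\<close> to which the added simplex will be
    collapsed.\<close>
  then obtain s where s: "s \<in> P" "s \<noteq> {}"
    using P(1) by (auto simp: abstract_complex_def)
  then obtain v where "v \<in> s" by blast
  with s \<eta> have "{\<eta> v} \<subseteq> \<eta> ` s" "\<eta> ` s \<in> L" by (auto simp: simplicial_map_def)
  with L have v: "{\<eta> v} \<in> L" unfolding abstract_complex_def by blast
  \<comment> \<open>A full simplex on \<open>Suc m\<close> vertices, disjoint from the copy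
    \<open>Inl\<close> of \<open>P\<close>, brings the dimension up to exactly
    \<open>m\<close>.\<close>
  define D where "D = {t :: ('p + nat) set. t \<noteq> {} \<and> t \<subseteq> Inr ` {..m}}"
  define Q where "Q = (\<lambda>s. Inl ` s) ` P \<union> D"
  define \<theta> where "\<theta> = case_sum \<eta> (\<lambda>_::nat. \<eta> v)"
  have cardtop: "card ((Inr :: nat \<Rightarrow> 'p + nat) ` {..m}) = Suc m"
    by (simp add: card_image)
  have cardQ: "card t \<le> Suc m" if "t \<in> Q" for t
    using that
  proof (unfold Q_def, elim UnE)
    assume "t \<in> D"
    then show ?thesis using card_mono[of "Inr ` {..m}" t] cardtop by (simp add: D_def)
  qed (auto simp: card_image card_simplex_le[OF P(2)])
  have "abstract_complex ((\<lambda>s. Inl ` s) ` P :: ('p + nat) set set)"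
    unfolding abstract_complex_def
  proof (intro conjI ballI allI impI)
    fix s t :: "('p + nat) set" assume "s \<in> (\<lambda>s. Inl ` s) ` P" "t \<subseteq> s \<and> t \<noteq> {}"
    then obtain r q where "r \<in> P" "q \<subseteq> r" "q \<noteq> {}" "t = Inl ` q"
      by (auto elim!: subset_imageE)
    with P(1) show "t \<in> (\<lambda>s. Inl ` s) ` P" unfolding abstract_complex_def by blast
  qed (use P(1) in \<open>auto simp: abstract_complex_def\<close>)
  moreover have "abstract_complex D"
    unfolding abstract_complex_def D_def by (auto intro: finite_subset)
  ultimately have Q: "abstract_complex Q"
    unfolding Q_def abstract_complex_def by blast
  have topQ: "Inr ` {..m} \<in> Q" by (auto simp: Q_def D_def)
  have dimQ: "complex_dim Q = enat m"
    unfolding complex_dim_def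
  proof (rule antisym)
    show "(SUP s\<in>Q. enat (card s - 1)) \<le> enat m"
      using cardQ by (intro SUP_least) fastforce
    show "enat m \<le> (SUP s\<in>Q. enat (card s - 1))"
      using SUP_upper[OF topQ, of "\<lambda>s. enat (card s - 1)"] by (simp only: cardtop) simp
  qed
  have "\<theta> ` t = {\<eta> v}" if "t \<in> D" for t
  proof -
    have "t \<noteq> {}" "\<forall>x\<in>t. \<theta> x = \<eta> v" using that by (auto simp: D_def \<theta>_def)
    then show ?thesis by force
  qed
  then have \<theta>: "simplicial_map Q L \<theta>"
    using \<eta> v by (auto simp: simplicial_map_def Q_def \<theta>_def image_image)
  have "Q \<noteq> {}" using topQ by blast
  \<comment> \<open>The vertices of \<open>Q\<close> lie in \<open>'p + nat\<close>, whereas the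
    definition tests complexes over \<open>'a + nat\<close>.\<close>
  from m_contiguous_on_any_vertex_type[OF good L Q this dimQ \<theta>]
  have "same_contiguity_class Q K' (\<phi> \<circ> \<theta>) (\<psi> \<circ> \<theta>)" .
  \<comment> \<open>Precomposing with the inclusion \<open>Inl\<close> forgets the added
    simplex.\<close>
  moreover have "simplicial_map P Q Inl" by (simp add: simplicial_map_def Q_def)
  ultimately have "same_contiguity_class P K' (\<phi> \<circ> \<theta> \<circ> Inl) (\<psi> \<circ> \<theta> \<circ> Inl)"
    by (rule same_contiguity_class_compose)
  moreover have "\<theta> \<circ> Inl = \<eta>" by (simp add: \<theta>_def fun_eq_iff)
  ultimately show ?thesis by (simp add: comp_assoc)
qed

lemma m_contiguous_on_antimono:
  assumes "m \<le> n" "abstract_complex L" "m_contiguous_on n L K' \<phi> \<psi>"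
  shows "m_contiguous_on m L K' \<phi> \<psi>"
  unfolding m_contiguous_on_def
  using m_contiguous_on_dim_le[OF assms(3,2)] assms(1) by (metis enat_ord_simps(1))

lemma m_contiguous_on_iff_same_contiguity_class:
  assumes "abstract_complex L" "complex_dim L \<le> enat m"
  shows "m_contiguous_on m L K' \<phi> \<psi> \<longleftrightarrow> same_contiguity_class L K' \<phi> \<psi>"
proof
  assume "m_contiguous_on m L K' \<phi> \<psi>"
  \<comment> \<open>\<open>L\<close> is its own test complex, even if it is empty or of dimension
    below \<open>m\<close>. The converse precomposes the chain with the test map.\<close>
  from m_contiguous_on_dim_le[OF this assms(1,1,2), of id]
  show "same_contiguity_class L K' \<phi> \<psi>" by (simp add: simplicial_map_def)
qed (unfold m_contiguous_on_def, blast intro: same_contiguity_class_compose)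

theorem corollary3p3:
  fixes K :: "'a set set" and K' :: "'b set set" and \<phi> \<psi> :: "'a \<Rightarrow> 'b"
  assumes "abstract_complex K" and "abstract_complex K'"
    and "edge_path_connected K" and "edge_path_connected K'"
    and "complex_dim K < \<infinity>"
    and "simplicial_map K K' \<phi>" and "simplicial_map K K' \<psi>"
  shows "mono (\<lambda>m. SDm m K K' \<phi> \<psi>) \<and>
         (\<forall>m. complex_dim K \<le> enat m \<longrightarrow> SDm m K K' \<phi> \<psi> = SD K K' \<phi> \<psi>)"
proof (intro conjI allI impI)
  show "mono (\<lambda>m. SDm m K K' \<phi> \<psi>)"
    unfolding SDm_def
    \<comment> \<open>The condition on each subcomplex gets stronger as \<open>m\<close> grows, so
      fewer covers qualify.\<close>
    by (intro monoI cover_number_mono) (unfold subcomplex_def, blast intro: m_contiguous_on_antimono)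
next
  fix m assume m: "complex_dim K \<le> enat m"
  \<comment> \<open>Subcomplexes inherit the dimension bound from \<open>K\<close>, so both
    invariants admit the same covers.\<close>
  have "m_contiguous_on m L K' \<phi> \<psi> \<longleftrightarrow> same_contiguity_class L K' \<phi> \<psi>" if "subcomplex L K" for L
    using that order_trans[OF complex_dim_mono m]
    by (intro m_contiguous_on_iff_same_contiguity_class) (simp_all add: subcomplex_def)
  then show "SDm m K K' \<phi> \<psi> = SD K K' \<phi> \<psi>"
    unfolding SDm_def SD_def by (intro antisym cover_number_mono) blast+
qed

end
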